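(* Let $\Sigma$ be a surface embedded in a Riemannian manifold $(M,\bar g)$. Defining $\mathcal{J}_M(X)=\gamma^{-1}\mathcal{P}(X)$ for all $X\in TM$, it holds that $\mathcal{J}_M(Y)=\mathcal{J}(Y)$ for all $Y\in T\Sigma$. That is, $\gamma^{-1}\mathcal{P}$ defines a complex structure on $T\Sigma$.
   Context: $\Sigma$ has dimension $2$. $x^1,\dots,x^m$ are local coordinates on $M$, $u^1,u^2$ local coordinates on $\Sigma$; the $x^i$ are regarded as functions of $u^1,u^2$ (the embedding), $\partial_a=\partial/\partial u^a$. Repeated indices are summed. $e_a=(\partial_ax^i)\partial_i$ is the basis of $T\Sigma\subset TM$, $g_{ab}=\bar g(e_a,e_b)$, $g=\det(g_{ab})$. $TM$ refers to tangent vectors of $M$ at points of $\Sigma$. $\rho$ is an arbitrary non-vanishing density on $\Sigma$, $\{f,h\}=\frac1\rho\varepsilon^{ab}(\partial_af)(\partial_bh)$ with $\varepsilon^{ab}$ antisymmetric, $\varepsilon^{12}=1$, and $\gamma=\sqrt g/\rho$. $\mathcal{P}^{ij}=\{x^i,x^j\}$, regarded as a map $TM\to TM$ by $\mathcal{P}(X)^i=\mathcal{P}^{ij}\bar g_{jk}X^k$. The complex structure $\mathcal{J}$ of $\Sigma$ associated with the induced metric is $$\mathcal{J}(X)=\frac{1}{\sqrt g}\varepsilon^{ac}g_{cb}X^be_a\qquad\text{for }X=X^be_b\in T\Sigma.$$ *)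

theory Defs
  imports "HOL-Analysis.Analysis"
begin

section \<open>Smooth maps\<close>

primrec Ck_on :: "nat \<Rightarrow> ('a::real_normed_vector) set \<Rightarrow> ('a \<Rightarrow> 'b::real_normed_vector) \<Rightarrow> bool" where
  "Ck_on 0 U f \<longleftrightarrow> continuous_on U f"
| "Ck_on (Suc k) U f \<longleftrightarrow>
     (\<forall>x\<in>U. f differentiable (at x)) \<and> (\<forall>v. Ck_on k U (\<lambda>x. frechet_derivative f (at x) v))"

text \<open>Only used for open \<open>U\<close>.\<close>

definition smooth_on :: "('a::real_normed_vector) set \<Rightarrow> ('a \<Rightarrow> 'b::real_normed_vector) \<Rightarrow> bool" where
  "smooth_on U f \<longleftrightarrow> (\<forall>k. Ck_on k U f)"

section \<open>Smooth manifolds\<close>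

text \<open>A chart is a domain together with a coordinate map; the values of the map outside the
  domain are irrelevant.\<close>

type_synonym ('p, 'n) chart = "'p set \<times> ('p \<Rightarrow> real ^ 'n)"

definition is_chart :: "'p topology \<Rightarrow> ('p, 'n::finite) chart \<Rightarrow> bool" where
  "is_chart X c \<longleftrightarrow> openin X (fst c) \<and> open (snd c ` fst c) \<and>
     homeomorphic_map (subtopology X (fst c)) (top_of_set (snd c ` fst c)) (snd c)"

definition param :: "('p, 'n) chart \<Rightarrow> real ^ 'n \<Rightarrow> 'p" where
  "param c = inv_into (fst c) (snd c)"

text \<open>A map between manifolds in local coordinates, and the set where this makes sense. Coordinate
  changes are the case of the identity map.\<close>

definition coord_rep ::
    "('s \<Rightarrow> 'p) \<Rightarrow> ('s, 'n) chart \<Rightarrow> ('p, 'm) chart \<Rightarrow> real ^ 'n \<Rightarrow> real ^ 'm" where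
  "coord_rep F c d = snd d \<circ> F \<circ> param c"

definition coord_dom ::
    "('s \<Rightarrow> 'p) \<Rightarrow> ('s, 'n) chart \<Rightarrow> ('p, 'm) chart \<Rightarrow> (real ^ 'n) set" where
  "coord_dom F c d = snd c ` {q \<in> fst c. F q \<in> fst d}"

abbreviation "coord_change \<equiv> coord_rep id"
abbreviation "change_dom \<equiv> coord_dom id"

text \<open>The atlas need not be maximal; taking it maximal lets the charts range over all
  local coordinate systems.\<close>

definition smooth_manifold :: "'p topology \<Rightarrow> ('p, 'n::finite) chart set \<Rightarrow> bool" where
  "smooth_manifold X A \<longleftrightarrow>
     Hausdorff_space X \<and> second_countable X \<and>
     (\<forall>c\<in>A. is_chart X c) \<and> (\<Union>c\<in>A. fst c) = topspace X \<and>
     (\<forall>c\<in>A. \<forall>d\<in>A. smooth_on (change_dom c d) (coord_change c d))"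

text \<open>A Riemannian metric is given by its component matrices in the charts, which have to
  transform as a covariant 2-tensor.\<close>

definition riemannian_metric ::
    "('p, 'm::finite) chart set \<Rightarrow> (('p, 'm) chart \<Rightarrow> real ^ 'm \<Rightarrow> real ^ 'm ^ 'm) \<Rightarrow> bool" where
  "riemannian_metric A gbar \<longleftrightarrow>
     (\<forall>c\<in>A. smooth_on (snd c ` fst c) (gbar c) \<and>
        (\<forall>y\<in>snd c ` fst c. transpose (gbar c y) = gbar c y \<and>
           (\<forall>v. v \<noteq> 0 \<longrightarrow> v \<bullet> (gbar c y *v v) > 0))) \<and>
     (\<forall>c\<in>A. \<forall>d\<in>A. \<forall>y\<in>change_dom c d. \<forall>v w.
        v \<bullet> (gbar c y *v w) =
        frechet_derivative (coord_change c d) (at y) v \<bullet>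
          (gbar d (coord_change c d y) *v frechet_derivative (coord_change c d) (at y) w))"

definition riemannian_manifold ::
    "'p topology \<Rightarrow> ('p, 'm::finite) chart set \<Rightarrow>
     (('p, 'm) chart \<Rightarrow> real ^ 'm \<Rightarrow> real ^ 'm ^ 'm) \<Rightarrow> bool" where
  "riemannian_manifold X A gbar \<longleftrightarrow> smooth_manifold X A \<and> riemannian_metric A gbar"

definition smooth_embedding ::
    "'s topology \<Rightarrow> ('s, 'n::finite) chart set \<Rightarrow> 'p topology \<Rightarrow> ('p, 'm::finite) chart set \<Rightarrow>
     ('s \<Rightarrow> 'p) \<Rightarrow> bool" where
  "smooth_embedding S B X A F \<longleftrightarrow>
     embedding_map S X F \<and>
     (\<forall>c\<in>B. \<forall>d\<in>A. smooth_on (coord_dom F c d) (coord_rep F c d) \<and>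
        (\<forall>u\<in>coord_dom F c d. inj (frechet_derivative (coord_rep F c d) (at u))))"

text \<open>A non-vanishing density, given by its components in the charts. The transformation law is
  only imposed at points where the change of coordinates preserves orientation. There the law with
  the Jacobian determinant and the one with its absolute value agree, so both conventions
  are covered.\<close>

definition nonvanishing_density ::
    "('s, 'n::finite) chart set \<Rightarrow> (('s, 'n) chart \<Rightarrow> real ^ 'n \<Rightarrow> real) \<Rightarrow> bool" where
  "nonvanishing_density B rho \<longleftrightarrow>
     (\<forall>c\<in>B. smooth_on (snd c ` fst c) (rho c) \<and> (\<forall>u\<in>snd c ` fst c. rho c u \<noteq> 0)) \<and>
     (\<forall>c\<in>B. \<forall>d\<in>B. \<forall>u\<in>change_dom c d.
        det (matrix (frechet_derivative (coord_change c d) (at u))) > 0 \<longrightarrow>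
        rho c u = det (matrix (frechet_derivative (coord_change c d) (at u))) *
                  rho d (coord_change c d u))"

section \<open>Local expressions on an embedded surface\<close>

text \<open>Below, \<open>x\<close> is the embedding in local coordinates, \<open>u\<close> the coordinates of a point of the
  surface, \<open>r\<close> the density in these coordinates and \<open>G\<close> the matrix \<open>(\<bar>g\<^sub>i\<^sub>j)\<close> as a function of the
  coordinates on the ambient manifold. The two elements of the index type \<open>2\<close> are \<open>1\<close> and \<open>2\<close>.\<close>

definition pd :: "2 \<Rightarrow> (real ^ 2 \<Rightarrow> real) \<Rightarrow> real ^ 2 \<Rightarrow> real" where
  "pd a f u = frechet_derivative f (at u) (axis a 1)"

definition eps :: "2 \<Rightarrow> 2 \<Rightarrow> real" where
  "eps a b = (if a = 1 \<and> b = 2 then 1 else if a = 2 \<and> b = 1 then -1 else 0)"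

definition poisson ::
    "(real ^ 2 \<Rightarrow> real) \<Rightarrow> (real ^ 2 \<Rightarrow> real) \<Rightarrow> (real ^ 2 \<Rightarrow> real) \<Rightarrow> real ^ 2 \<Rightarrow> real" where
  "poisson r f h u = 1 / r u * (\<Sum>a\<in>UNIV. \<Sum>b\<in>UNIV. eps a b * pd a f u * pd b h u)"

definition frame :: "(real ^ 2 \<Rightarrow> real ^ 'm) \<Rightarrow> real ^ 2 \<Rightarrow> 2 \<Rightarrow> real ^ 'm" where
  "frame x u a = (\<chi> i. pd a (\<lambda>v. x v $ i) u)"

definition tangent_plane :: "(real ^ 2 \<Rightarrow> real ^ 'm::finite) \<Rightarrow> real ^ 2 \<Rightarrow> (real ^ 'm) set" where
  "tangent_plane x u = span (range (frame x u))"

definition induced_metric ::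
    "(real ^ 'm \<Rightarrow> real ^ 'm ^ 'm) \<Rightarrow> (real ^ 2 \<Rightarrow> real ^ 'm::finite) \<Rightarrow> real ^ 2 \<Rightarrow> real ^ 2 ^ 2" where
  "induced_metric G x u = (\<chi> a b. frame x u a \<bullet> (G (x u) *v frame x u b))"

definition gam ::
    "(real ^ 2 \<Rightarrow> real) \<Rightarrow> (real ^ 'm \<Rightarrow> real ^ 'm ^ 'm) \<Rightarrow> (real ^ 2 \<Rightarrow> real ^ 'm::finite) \<Rightarrow>
     real ^ 2 \<Rightarrow> real" where
  "gam r G x u = sqrt (det (induced_metric G x u)) / r u"

definition P_comp ::
    "(real ^ 2 \<Rightarrow> real) \<Rightarrow> (real ^ 2 \<Rightarrow> real ^ 'm::finite) \<Rightarrow> real ^ 2 \<Rightarrow> 'm \<Rightarrow> 'm \<Rightarrow> real" where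
  "P_comp r x u i j = poisson r (\<lambda>v. x v $ i) (\<lambda>v. x v $ j) u"

definition P_map ::
    "(real ^ 2 \<Rightarrow> real) \<Rightarrow> (real ^ 'm \<Rightarrow> real ^ 'm ^ 'm) \<Rightarrow> (real ^ 2 \<Rightarrow> real ^ 'm::finite) \<Rightarrow>
     real ^ 2 \<Rightarrow> real ^ 'm \<Rightarrow> real ^ 'm" where
  "P_map r G x u X =
     (\<chi> i. \<Sum>j\<in>UNIV. \<Sum>k\<in>UNIV. P_comp r x u i j * G (x u) $ j $ k * X $ k)"

definition J_M ::
    "(real ^ 2 \<Rightarrow> real) \<Rightarrow> (real ^ 'm \<Rightarrow> real ^ 'm ^ 'm) \<Rightarrow> (real ^ 2 \<Rightarrow> real ^ 'm::finite) \<Rightarrow>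
     real ^ 2 \<Rightarrow> real ^ 'm \<Rightarrow> real ^ 'm" where
  "J_M r G x u X = inverse (gam r G x u) *\<^sub>R P_map r G x u X"

definition frame_coeffs :: "(real ^ 2 \<Rightarrow> real ^ 'm::finite) \<Rightarrow> real ^ 2 \<Rightarrow> real ^ 'm \<Rightarrow> real ^ 2" where
  "frame_coeffs x u X = (THE \<xi>. X = (\<Sum>b\<in>UNIV. \<xi> $ b *\<^sub>R frame x u b))"

text \<open>Meaningful on \<open>tangent_plane x u\<close> only.\<close>

definition J_surf ::
    "(real ^ 'm \<Rightarrow> real ^ 'm ^ 'm) \<Rightarrow> (real ^ 2 \<Rightarrow> real ^ 'm::finite) \<Rightarrow>
     real ^ 2 \<Rightarrow> real ^ 'm \<Rightarrow> real ^ 'm" where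
  "J_surf G x u X =
     (1 / sqrt (det (induced_metric G x u))) *\<^sub>R
       (\<Sum>a\<in>UNIV. \<Sum>b\<in>UNIV. \<Sum>c\<in>UNIV.
          (eps a c * induced_metric G x u $ c $ b * frame_coeffs x u X $ b) *\<^sub>R frame x u a)"

definition complex_structure_on :: "('v::real_vector) set \<Rightarrow> ('v \<Rightarrow> 'v) \<Rightarrow> bool" where
  "complex_structure_on V F \<longleftrightarrow>
     (\<forall>v\<in>V. F v \<in> V \<and> F (F v) = - v) \<and>
     (\<forall>v\<in>V. \<forall>w\<in>V. \<forall>s t::real. F (s *\<^sub>R v + t *\<^sub>R w) = s *\<^sub>R F v + t *\<^sub>R F w)"

end

theory Submission
  imports Defs
begin

text \<open>
  Everything happens at one point of the surface, where the claim is linear algebra. The bracket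
  \<open>\<P>\<^sup>i\<^sup>j = (1/\<rho>) \<epsilon>\<^sup>a\<^sup>b (\<partial>\<^sub>a x\<^sup>i) (\<partial>\<^sub>b x\<^sup>j)\<close> is the bivector
  \<open>e\<^sub>1 \<and> e\<^sub>2\<close> up to the factor \<open>1/\<rho>\<close>. Lowering its second index with the ambient metric
  and dividing by \<open>\<gamma> = \<surd>g/\<rho>\<close> cancels the density, sign included, so for every ambient
  vector \<open>X\<close>,
  \<open>\<J>\<^sub>M X = (1/\<surd>g) (\<langle>e\<^sub>2, X\<rangle> e\<^sub>1 - \<langle>e\<^sub>1, X\<rangle> e\<^sub>2)\<close>,
  which is lemma \<open>J_M_eq_wedge\<close>. For \<open>X = \<xi>\<^sup>b e\<^sub>b\<close> the pairings are
  \<open>\<langle>e\<^sub>c, X\<rangle> = g\<^sub>c\<^sub>b \<xi>\<^sup>b\<close>, which turns the right-hand side into the definition of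
  \<open>\<J>\<close>. Applying the formula twice to a tangent vector gives
  \<open>-(g\<^sub>1\<^sub>1 g\<^sub>2\<^sub>2 - g\<^sub>1\<^sub>2\<^sup>2)/g = -1\<close> times that vector by the symmetry of \<open>g\<^sub>a\<^sub>b\<close>, so \<open>\<J>\<^sub>M\<close> squares to \<open>-1\<close> on
  the tangent plane.

  Two facts are needed from the geometry. The frame must be linearly independent, so that tangent
  vectors have unique components: the frame consists of the columns of the differential of the
  embedding in coordinates, which is injective. And \<open>g\<close> must be positive, which is the strict
  Cauchy-Schwarz inequality for the ambient metric (\<open>det_induced_metric_pos\<close>).
\<close>

section \<open>The frame and the differential of the embedding\<close>

lemma frame_eq_frechet_derivative:
  fixes x :: "real ^ 2 \<Rightarrow> real ^ 'm::finite"
  assumes "x differentiable (at u)"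
  shows "frame x u a = frechet_derivative x (at u) (axis a 1)"
proof -
  have D: "(x has_derivative frechet_derivative x (at u)) (at u)"
    using assms by (simp add: frechet_derivative_works)
  have "frechet_derivative (\<lambda>v. x v $ i) (at u) = (\<lambda>h. frechet_derivative x (at u) h $ i)" for i
    using bounded_linear.has_derivative[OF bounded_linear_vec_nth D] frechet_derivative_at by metis
  then show ?thesis
    by (simp add: frame_def pd_def vec_eq_iff)
qed

text \<open>The immersion condition thus says that \<open>\<xi> \<mapsto> \<xi>\<^sup>b e\<^sub>b\<close> is injective, and linear
  independence of the frame is assumed below in this form.\<close>

lemma frechet_derivative_eq_frame_sum:
  fixes x :: "real ^ 2 \<Rightarrow> real ^ 'm::finite"
  assumes "x differentiable (at u)"
  shows "frechet_derivative x (at u) \<xi> = (\<Sum>b\<in>UNIV. \<xi> $ b *\<^sub>R frame x u b)"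
proof -
  have lin: "linear (frechet_derivative x (at u))"
    using assms by (rule linear_frechet_derivative)
  have "frechet_derivative x (at u) \<xi>
      = frechet_derivative x (at u) (\<Sum>b\<in>UNIV. \<xi> $ b *\<^sub>R axis b 1)"
    using basis_expansion[of \<xi>] by (simp add: scalar_mult_eq_scaleR)
  also have "\<dots> = (\<Sum>b\<in>UNIV. \<xi> $ b *\<^sub>R frame x u b)"
    by (simp add: frame_eq_frechet_derivative[OF assms] linear_sum[OF lin] linear_cmul[OF lin])
  finally show ?thesis .
qed

lemma tangent_plane_eq_range:
  fixes x :: "real ^ 2 \<Rightarrow> real ^ 'm::finite"
  shows "tangent_plane x u = range (\<lambda>\<xi>::real^2. \<Sum>b\<in>UNIV. \<xi> $ b *\<^sub>R frame x u b)"
proof (intro equalityI subsetI)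
  fix y assume "y \<in> tangent_plane x u"
  then obtain s t where "y = s *\<^sub>R frame x u 1 + t *\<^sub>R frame x u 2"
    by (auto simp: tangent_plane_def UNIV_2 span_insert span_singleton algebra_simps)
  then have "y = (\<Sum>b\<in>UNIV. (vector [s, t] :: real^2) $ b *\<^sub>R frame x u b)"
    by (simp add: sum_2)
  then show "y \<in> range (\<lambda>\<xi>::real^2. \<Sum>b\<in>UNIV. \<xi> $ b *\<^sub>R frame x u b)"
    by blast
qed (auto simp: tangent_plane_def intro!: span_sum span_scale intro: span_base)

lemma frame_coeffs_frame_sum:
  fixes x :: "real ^ 2 \<Rightarrow> real ^ 'm::finite"
  assumes "inj (\<lambda>\<xi>::real^2. \<Sum>b\<in>UNIV. \<xi> $ b *\<^sub>R frame x u b)"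
  shows "frame_coeffs x u (\<Sum>b\<in>UNIV. \<xi> $ b *\<^sub>R frame x u b) = \<xi>"
  unfolding frame_coeffs_def using injD[OF assms] by (intro the_equality) auto

section \<open>The induced metric\<close>

lemma inner_matrix_sym:
  fixes H :: "real ^ 'm::finite ^ 'm"
  assumes "transpose H = H"
  shows "v \<bullet> (H *v w) = w \<bullet> (H *v v)"
  by (metis assms dot_lmul_matrix inner_commute transpose_matrix_vector)

lemma induced_metric_sym:
  fixes x :: "real ^ 2 \<Rightarrow> real ^ 'm::finite"
  assumes "transpose (G (x u)) = G (x u)"
  shows "induced_metric G x u $ a $ b = induced_metric G x u $ b $ a"
  using inner_matrix_sym[OF assms] by (simp add: induced_metric_def)

text \<open>Strict Cauchy-Schwarz: the component of \<open>e\<^sub>2\<close> orthogonal to \<open>e\<^sub>1\<close>, scaled by \<open>g\<^sub>1\<^sub>1\<close>, is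
  \<open>w = g\<^sub>1\<^sub>1 e\<^sub>2 - g\<^sub>1\<^sub>2 e\<^sub>1\<close>. It is nonzero by independence and has squared length \<open>g\<^sub>1\<^sub>1 g\<close>.\<close>

lemma det_induced_metric_pos:
  fixes x :: "real ^ 2 \<Rightarrow> real ^ 'm::finite"
  assumes inj: "inj (\<lambda>\<xi>::real^2. \<Sum>b\<in>UNIV. \<xi> $ b *\<^sub>R frame x u b)"
    and sym: "transpose (G (x u)) = G (x u)"
    and pos: "\<And>v. v \<noteq> 0 \<Longrightarrow> v \<bullet> (G (x u) *v v) > 0"
  shows "det (induced_metric G x u) > 0"
proof -
  define e1 e2 where "e1 = frame x u 1" and "e2 = frame x u 2"
  define g11 g12 g22 where "g11 = e1 \<bullet> (G (x u) *v e1)" and "g12 = e1 \<bullet> (G (x u) *v e2)"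
    and "g22 = e2 \<bullet> (G (x u) *v e2)"
  have g21: "e2 \<bullet> (G (x u) *v e1) = g12"
    unfolding g12_def by (rule inner_matrix_sym[OF sym])
  have indep: "s = 0 \<and> t = 0" if "s *\<^sub>R e1 + t *\<^sub>R e2 = 0" for s t
  proof -
    have "(\<Sum>b\<in>UNIV. (vector [s, t] :: real^2) $ b *\<^sub>R frame x u b)
        = (\<Sum>b\<in>UNIV. (0 :: real^2) $ b *\<^sub>R frame x u b)"
      using that by (simp add: sum_2 e1_def e2_def)
    then have "(vector [s, t] :: real^2) = 0"
      by (rule injD[OF inj])
    then show ?thesis
      by (simp add: vec_eq_iff forall_2)
  qed
  have "e1 \<noteq> 0"
    using indep[of 1 0] by auto
  then have g11: "g11 > 0"
    unfolding g11_def by (rule pos)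
  define w where "w = (- g12) *\<^sub>R e1 + g11 *\<^sub>R e2"
  have "w \<noteq> 0"
    using indep[of "- g12" g11] g11 by (auto simp: w_def)
  then have "0 < w \<bullet> (G (x u) *v w)"
    by (rule pos)
  also have "w \<bullet> (G (x u) *v w) = g11 * (g11 * g22 - g12 * g12)"
    unfolding w_def
    by (simp add: matrix_vector_right_distrib matrix_vector_mult_scaleR inner_add_left
        inner_add_right g21 g11_def[symmetric] g12_def[symmetric] g22_def[symmetric]
        del: scaleR_minus_left)
  finally have "g11 * g22 - g12 * g12 > 0"
    using g11 by (simp add: zero_less_mult_iff)
  then show ?thesis
    using g21 by (simp add: det_2 induced_metric_def g11_def g12_def g22_def e1_def e2_def)
qed

section \<open>The Poisson bivector as a map\<close>

lemma P_map_eq_wedge: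
  fixes x :: "real ^ 2 \<Rightarrow> real ^ 'm::finite"
  shows "P_map r G x u X = (1 / r u) *\<^sub>R
    ((frame x u 2 \<bullet> (G (x u) *v X)) *\<^sub>R frame x u 1 - (frame x u 1 \<bullet> (G (x u) *v X)) *\<^sub>R frame x u 2)"
proof -
  have P: "P_comp r x u i j
      = 1 / r u * (frame x u 1 $ i * frame x u 2 $ j - frame x u 2 $ i * frame x u 1 $ j)" for i j
    by (simp add: P_comp_def poisson_def frame_def sum_2 eps_def)
  have "P_map r G x u X $ i = (\<Sum>j\<in>UNIV. P_comp r x u i j * (G (x u) *v X) $ j)" for i
    by (simp add: P_map_def matrix_vector_mult_def sum_distrib_left mult.assoc)
  then show ?thesis
    by (simp add: vec_eq_iff P inner_vec_def sum_distrib_left sum_distrib_right sum_subtractf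
        algebra_simps)
qed

text \<open>The density occurs once in \<open>\<P>\<close> and once in \<open>\<gamma>\<close>, and disappears together with its
  sign.\<close>

lemma J_M_eq_wedge:
  fixes x :: "real ^ 2 \<Rightarrow> real ^ 'm::finite"
  assumes "r u \<noteq> 0"
  shows "J_M r G x u X = (1 / sqrt (det (induced_metric G x u))) *\<^sub>R
    ((frame x u 2 \<bullet> (G (x u) *v X)) *\<^sub>R frame x u 1 - (frame x u 1 \<bullet> (G (x u) *v X)) *\<^sub>R frame x u 2)"
  using assms by (simp add: J_M_def P_map_eq_wedge gam_def inverse_eq_divide)

lemma J_M_linear:
  fixes x :: "real ^ 2 \<Rightarrow> real ^ 'm::finite"
  assumes "r u \<noteq> 0"
  shows "J_M r G x u (s *\<^sub>R v + t *\<^sub>R w) = s *\<^sub>R J_M r G x u v + t *\<^sub>R J_M r G x u w"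
  by (simp add: J_M_eq_wedge[of r u, OF assms] matrix_vector_right_distrib matrix_vector_mult_scaleR
      inner_add_right algebra_simps)

lemma J_M_frame_sum:
  fixes x :: "real ^ 2 \<Rightarrow> real ^ 'm::finite"
    and G :: "real ^ 'm \<Rightarrow> real ^ 'm ^ 'm"
  assumes "r u \<noteq> 0"
  defines "g \<equiv> induced_metric G x u"
  shows "J_M r G x u (\<Sum>b\<in>UNIV. \<xi> $ b *\<^sub>R frame x u b)
    = (1 / sqrt (det g)) *\<^sub>R ((g $ 2 $ 1 * \<xi> $ 1 + g $ 2 $ 2 * \<xi> $ 2) *\<^sub>R frame x u 1
        - (g $ 1 $ 1 * \<xi> $ 1 + g $ 1 $ 2 * \<xi> $ 2) *\<^sub>R frame x u 2)"
  using assms(1)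
  by (simp add: J_M_eq_wedge[of r u] g_def induced_metric_def sum_2 matrix_vector_right_distrib
      matrix_vector_mult_scaleR inner_add_right mult.commute)

section \<open>Comparison with the complex structure of the surface\<close>

lemma J_M_eq_J_surf:
  fixes x :: "real ^ 2 \<Rightarrow> real ^ 'm::finite"
  assumes inj: "inj (\<lambda>\<xi>::real^2. \<Sum>b\<in>UNIV. \<xi> $ b *\<^sub>R frame x u b)"
    and r: "r u \<noteq> 0"
    and Y: "Y \<in> tangent_plane x u"
  shows "J_M r G x u Y = J_surf G x u Y"
proof -
  obtain \<xi> :: "real^2" where \<xi>: "Y = (\<Sum>b\<in>UNIV. \<xi> $ b *\<^sub>R frame x u b)"
    using Y unfolding tangent_plane_eq_range by blast
  show ?thesis
    unfolding \<xi> J_surf_def frame_coeffs_frame_sum[OF inj] J_M_frame_sum[of r u, OF r]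
    by (simp add: sum_2 eps_def algebra_simps)
qed

lemma complex_structure_on_J_M:
  fixes x :: "real ^ 2 \<Rightarrow> real ^ 'm::finite"
  assumes inj: "inj (\<lambda>\<xi>::real^2. \<Sum>b\<in>UNIV. \<xi> $ b *\<^sub>R frame x u b)"
    and sym: "transpose (G (x u)) = G (x u)"
    and pos: "\<And>v. v \<noteq> 0 \<Longrightarrow> v \<bullet> (G (x u) *v v) > 0"
    and r: "r u \<noteq> 0"
  shows "complex_structure_on (tangent_plane x u) (J_M r G x u)"
  unfolding complex_structure_on_def
proof (intro conjI ballI allI)
  fix v w s t
  show "J_M r G x u (s *\<^sub>R v + t *\<^sub>R w) = s *\<^sub>R J_M r G x u v + t *\<^sub>R J_M r G x u w"
    by (rule J_M_linear[of r u, OF r])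
next
  fix v assume "v \<in> tangent_plane x u"
  then obtain \<xi> :: "real^2" where \<xi>: "v = (\<Sum>b\<in>UNIV. \<xi> $ b *\<^sub>R frame x u b)"
    unfolding tangent_plane_eq_range by blast
  define g where "g = induced_metric G x u"
  define q where "q = sqrt (det g)"
  have detg: "det g > 0"
    unfolding g_def by (rule det_induced_metric_pos[of x u G, OF inj sym pos])
  have q: "q > 0" "q * q = g $ 1 $ 1 * g $ 2 $ 2 - g $ 1 $ 2 * g $ 1 $ 2"
    using detg induced_metric_sym[of G x u 2 1, OF sym] by (simp_all add: q_def det_2 g_def)
  have g21: "g $ 2 $ 1 = g $ 1 $ 2"
    unfolding g_def by (rule induced_metric_sym[of G x u, OF sym])
  \<comment> \<open>The components of the image of \<open>v\<close>; feeding them back into the same formula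
    leaves the determinant \<open>q * q\<close> as a factor, which cancels.\<close>
  define \<eta> :: "real^2" where "\<eta> = vector [(g $ 1 $ 2 * \<xi> $ 1 + g $ 2 $ 2 * \<xi> $ 2) / q,
      - (g $ 1 $ 1 * \<xi> $ 1 + g $ 1 $ 2 * \<xi> $ 2) / q]"
  have Jv: "J_M r G x u v = (\<Sum>b\<in>UNIV. \<eta> $ b *\<^sub>R frame x u b)"
    unfolding \<xi> J_M_frame_sum[of r u, OF r] g_def[symmetric] q_def[symmetric] g21
    by (simp add: \<eta>_def sum_2 divide_inverse mult.commute scaleR_diff_right algebra_simps)
  then show "J_M r G x u v \<in> tangent_plane x u"
    unfolding tangent_plane_eq_range by blast
  have \<eta>: "q * \<eta> $ 1 = g $ 1 $ 2 * \<xi> $ 1 + g $ 2 $ 2 * \<xi> $ 2"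
    "q * \<eta> $ 2 = - (g $ 1 $ 1 * \<xi> $ 1 + g $ 1 $ 2 * \<xi> $ 2)"
    using q(1) by (simp_all add: \<eta>_def)
  have "q * (g $ 1 $ 2 * \<eta> $ 1 + g $ 2 $ 2 * \<eta> $ 2)
      = g $ 1 $ 2 * (q * \<eta> $ 1) + g $ 2 $ 2 * (q * \<eta> $ 2)"
    by (simp add: algebra_simps)
  also have "\<dots> = q * (q * - \<xi> $ 1)"
    unfolding \<eta> mult.assoc[symmetric] q(2) by (simp add: algebra_simps)
  finally have "g $ 1 $ 2 * \<eta> $ 1 + g $ 2 $ 2 * \<eta> $ 2 = q * - \<xi> $ 1"
    using q(1) by (metis mult_left_cancel less_irrefl)
  then have c1: "(g $ 1 $ 2 * \<eta> $ 1 + g $ 2 $ 2 * \<eta> $ 2) / q = - \<xi> $ 1"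
    using q(1) by simp
  have "q * (g $ 1 $ 1 * \<eta> $ 1 + g $ 1 $ 2 * \<eta> $ 2)
      = g $ 1 $ 1 * (q * \<eta> $ 1) + g $ 1 $ 2 * (q * \<eta> $ 2)"
    by (simp add: algebra_simps)
  also have "\<dots> = q * q * \<xi> $ 2"
    unfolding \<eta> q(2) by (simp add: algebra_simps)
  finally have c2: "(g $ 1 $ 1 * \<eta> $ 1 + g $ 1 $ 2 * \<eta> $ 2) / q = \<xi> $ 2"
    using q(1) by (simp add: divide_eq_eq mult.assoc)
  have "J_M r G x u (J_M r G x u v)
      = ((g $ 1 $ 2 * \<eta> $ 1 + g $ 2 $ 2 * \<eta> $ 2) / q) *\<^sub>R frame x u 1
        - ((g $ 1 $ 1 * \<eta> $ 1 + g $ 1 $ 2 * \<eta> $ 2) / q) *\<^sub>R frame x u 2"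
    unfolding Jv J_M_frame_sum[of r u, OF r] g_def[symmetric] q_def[symmetric] g21
    by (simp add: divide_inverse mult.commute scaleR_diff_right)
  also have "\<dots> = - v"
    unfolding c1 c2 by (simp add: \<xi> sum_2)
  finally show "J_M r G x u (J_M r G x u v) = - v" .
qed

section \<open>Embedded surfaces\<close>

lemma param_left_inverse:
  assumes "is_chart S c" "q \<in> fst c"
  shows "param c (snd c q) = q"
proof -
  have "inj_on (snd c) (topspace (subtopology S (fst c)))"
    using assms(1) homeomorphic_imp_injective_map unfolding is_chart_def by blast
  moreover have "topspace (subtopology S (fst c)) = fst c"
    using assms(1) openin_subset unfolding is_chart_def by (metis topspace_subtopology_subset)
  ultimately show ?thesis
    using assms(2) by (simp add: param_def)
qed

theorem theorem6p1:
  fixes X :: "'p topology"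
    and A :: "('p, 'm::finite) chart set"
    and gbar :: "('p, 'm) chart \<Rightarrow> real ^ 'm \<Rightarrow> real ^ 'm ^ 'm"
    and S :: "'s topology"
    and B :: "('s, 2) chart set"
    and F :: "'s \<Rightarrow> 'p"
    and rho :: "('s, 2) chart \<Rightarrow> real ^ 2 \<Rightarrow> real"
  assumes "riemannian_manifold X A gbar"
    and "smooth_manifold S B"
    and "smooth_embedding S B X A F"
    and "nonvanishing_density B rho"
  shows "\<forall>c\<in>B. \<forall>d\<in>A. \<forall>u\<in>coord_dom F c d.
    (\<forall>Y\<in>tangent_plane (coord_rep F c d) u.
       J_M (rho c) (gbar d) (coord_rep F c d) u Y = J_surf (gbar d) (coord_rep F c d) u Y) \<and>
    complex_structure_on (tangent_plane (coord_rep F c d) u)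
      (J_M (rho c) (gbar d) (coord_rep F c d) u)"
proof (intro ballI)
  fix c d u assume c: "c \<in> B" and d: "d \<in> A" and u: "u \<in> coord_dom F c d"
  let ?x = "coord_rep F c d"
  have "smooth_on (coord_dom F c d) ?x" and inj: "inj (frechet_derivative ?x (at u))"
    using assms(3) c d u by (auto simp: smooth_embedding_def)
  then have "Ck_on (Suc 0) (coord_dom F c d) ?x"
    unfolding smooth_on_def by blast
  then have "?x differentiable (at u)"
    using u by simp
  then have "frechet_derivative ?x (at u) = (\<lambda>\<xi>. \<Sum>b\<in>UNIV. \<xi> $ b *\<^sub>R frame ?x u b)"
    by (intro ext frechet_derivative_eq_frame_sum)
  with inj have indep: "inj (\<lambda>\<xi>::real^2. \<Sum>b\<in>UNIV. \<xi> $ b *\<^sub>R frame ?x u b)"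
    by simp
  obtain q where q: "q \<in> fst c" "F q \<in> fst d" "u = snd c q"
    using u by (auto simp: coord_dom_def)
  have "is_chart S c"
    using assms(2) c by (simp add: smooth_manifold_def)
  then have "?x u \<in> snd d ` fst d"
    using q by (simp add: coord_rep_def param_left_inverse)
  then have sym: "transpose (gbar d (?x u)) = gbar d (?x u)"
    and pos: "\<And>v. v \<noteq> 0 \<Longrightarrow> v \<bullet> (gbar d (?x u) *v v) > 0"
    using assms(1) d unfolding riemannian_manifold_def riemannian_metric_def by blast+
  have r: "rho c u \<noteq> 0"
    using assms(4) c q unfolding nonvanishing_density_def by blast
  show "(\<forall>Y\<in>tangent_plane ?x u. J_M (rho c) (gbar d) ?x u Y = J_surf (gbar d) ?x u Y) \<and>
      complex_structure_on (tangent_plane ?x u) (J_M (rho c) (gbar d) ?x u)"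
    using J_M_eq_J_surf[of ?x u "rho c", OF indep r]
      complex_structure_on_J_M[of ?x u "gbar d" "rho c", OF indep sym pos r] by blast
qed

end
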